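(* All subshifts generated by eventually periodic sequences are flow equivalent: if $x$ and $x'$ are eventually periodic bi-infinite sequences over finite alphabets, and $X$ and $X'$ are the subshifts generated by $x$ and $x'$ respectively, then $X$ and $X'$ are flow equivalent.
   Context: For a finite alphabet $\mathcal A$, $\mathcal A^{\mathbb Z}$ is the space of bi-infinite sequences $x=(x_i)_{i\in\mathbb Z}$ with the product topology (of the discrete topology on $\mathcal A$); the shift is $\sigma(x)_i=x_{i+1}$. A sequence $x$ is periodic if $\sigma^N(x)=x$ for some integer $N>0$. For integers $i\le j$, $x_{[i,j]}$ denotes the word $x_ix_{i+1}\cdots x_j$. A non-periodic $x\in\mathcal A^{\mathbb Z}$ is eventually periodic if there are integers $i$ and $n>0$ such that, removing the word $v=x_{[i+1,i+n]}$ occurring at that position, the resulting sequence $p_v(x)$ defined by $p_v(x)_k=x_k$ for $k\le i$ and $p_v(x)_k=x_{k+n}$ for $k>i$ is periodic. The subshift generated by $x$ is the closure of the orbit $\{\sigma^k(x):k\in\mathbb Z\}$ in $\mathcal A^{\mathbb Z}$. For a subshift $X$, its suspension is $\Sigma X=(X\times\mathbb R)/\sim$, where $(x,s)\sim(y,t)$ when $y=\sigma^n(x)$ and $t=s-n$ for some $n\in\mathbb Z$; the class of $(x,s)$ is written $[x,s]$. The natural flow on $\Sigma X$ is $[x,s]\mapsto[x,s+t]$, $t\in\mathbb R$, and its orbits are the flow lines. Two subshifts $X$ and $Y$ are flow equivalent if there is a homeomorphism $\Sigma X\to\Sigma Y$ mapping flow lines to flow lines and preserving their orientation. *)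

theory Defs
  imports "HOL-Analysis.Analysis"
begin

section \<open>Bi-infinite sequences and subshifts\<close>

text \<open>The alphabet is (the universe of) a type \<open>'a\<close>, of class \<open>finite\<close> where it matters.\<close>

definition full_shift :: "(int \<Rightarrow> 'a) topology" where
  "full_shift = product_topology (\<lambda>_. discrete_topology UNIV) UNIV"

text \<open>\<open>shift_pow n\<close> is the \<open>n\<close>-th power, for an arbitrary integer \<open>n\<close>, of the shift map
  \<open>shift_pow 1\<close>; see the lemmas below.\<close>

definition shift_pow :: "int \<Rightarrow> (int \<Rightarrow> 'a) \<Rightarrow> int \<Rightarrow> 'a" where
  "shift_pow n x = (\<lambda>i. x (i + n))"

definition periodic :: "(int \<Rightarrow> 'a) \<Rightarrow> bool" where
  "periodic x \<longleftrightarrow> (\<exists>N>0. shift_pow N x = x)"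

text \<open>Removal of the word of length \<open>n\<close> occupying the positions \<open>i + 1, \<dots>, i + n\<close>.\<close>

definition remove_word :: "int \<Rightarrow> int \<Rightarrow> (int \<Rightarrow> 'a) \<Rightarrow> int \<Rightarrow> 'a" where
  "remove_word i n x = (\<lambda>k. if k \<le> i then x k else x (k + n))"

definition eventually_periodic :: "(int \<Rightarrow> 'a) \<Rightarrow> bool" where
  "eventually_periodic x \<longleftrightarrow> \<not> periodic x \<and> (\<exists>i n. n > 0 \<and> periodic (remove_word i n x))"

definition generated_subshift :: "(int \<Rightarrow> 'a) \<Rightarrow> (int \<Rightarrow> 'a) set" where
  "generated_subshift x = full_shift closure_of (range (\<lambda>k. shift_pow k x))"

lemma shift_pow_0: "shift_pow 0 x = x"
  by (simp add: shift_pow_def)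

lemma shift_pow_add: "shift_pow m (shift_pow n x) = shift_pow (m + n) x"
  by (simp add: shift_pow_def algebra_simps)

lemma shift_pow_of_nat: "shift_pow (int n) = shift_pow 1 ^^ n"
proof (induction n)
  case 0
  show ?case by (simp add: fun_eq_iff shift_pow_def)
next
  case (Suc n)
  have "shift_pow (int (Suc n)) x = (shift_pow 1 ^^ Suc n) x" for x :: "int \<Rightarrow> 'a"
    using shift_pow_add[of 1 "int n" x] Suc.IH by (simp add: algebra_simps)
  then show ?case by blast
qed

section \<open>The suspension and its flow\<close>

definition suspension_rel :: "(int \<Rightarrow> 'a) set \<Rightarrow> (((int \<Rightarrow> 'a) \<times> real) \<times> ((int \<Rightarrow> 'a) \<times> real)) set" where
  "suspension_rel X = {((x, s), (y, t)). x \<in> X \<and> y \<in> X \<and>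
     (\<exists>n. y = shift_pow n x \<and> t = s - of_int n)}"

definition suspension_class :: "(int \<Rightarrow> 'a) set \<Rightarrow> (int \<Rightarrow> 'a) \<times> real \<Rightarrow> ((int \<Rightarrow> 'a) \<times> real) set" where
  "suspension_class X p = suspension_rel X `` {p}"

abbreviation shift_cylinder :: "(int \<Rightarrow> 'a) set \<Rightarrow> ((int \<Rightarrow> 'a) \<times> real) topology" where
  "shift_cylinder X \<equiv> prod_topology (subtopology full_shift X) euclideanreal"

text \<open>The quotient topology on the set of equivalence classes; compare \<open>quotient_map_suspension\<close>.\<close>

definition suspension :: "(int \<Rightarrow> 'a) set \<Rightarrow> ((int \<Rightarrow> 'a) \<times> real) set topology" where
  "suspension X = topology (\<lambda>U. U \<subseteq> (X \<times> UNIV) // suspension_rel X \<and>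
     openin (shift_cylinder X) {p \<in> X \<times> UNIV. suspension_class X p \<in> U})"

text \<open>On an equivalence class, i.e. a set of pairs, the flow acts elementwise;
  see \<open>suspension_flow_class\<close>.\<close>

definition suspension_flow :: "real \<Rightarrow> ((int \<Rightarrow> 'a) \<times> real) set \<Rightarrow> ((int \<Rightarrow> 'a) \<times> real) set" where
  "suspension_flow t P = (\<lambda>(x, s). (x, s + t)) ` P"

definition flow_lines :: "(int \<Rightarrow> 'a) set \<Rightarrow> ((int \<Rightarrow> 'a) \<times> real) set set set" where
  "flow_lines X = {range (\<lambda>t. suspension_flow t P) | P. P \<in> topspace (suspension X)}"

text \<open>A map preserves the orientation of the flow lines if along each of them it is, in terms of
  the flow parameters, an increasing homeomorphism of the real line. A flow line may be a closed
  orbit, so the reparametrisation is a lift and has to be required to be continuous.\<close>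

definition orientation_preserving ::
  "(int \<Rightarrow> 'a) set \<Rightarrow> (((int \<Rightarrow> 'a) \<times> real) set \<Rightarrow> ((int \<Rightarrow> 'b) \<times> real) set) \<Rightarrow> bool" where
  "orientation_preserving X h \<longleftrightarrow> (\<forall>P \<in> topspace (suspension X). \<exists>\<tau> :: real \<Rightarrow> real.
     strict_mono \<tau> \<and> continuous_on UNIV \<tau> \<and> surj \<tau> \<and>
     (\<forall>t. h (suspension_flow t P) = suspension_flow (\<tau> t) (h P)))"

definition flow_equivalent :: "(int \<Rightarrow> 'a) set \<Rightarrow> (int \<Rightarrow> 'b) set \<Rightarrow> bool" where
  "flow_equivalent X Y \<longleftrightarrow> (\<exists>h. homeomorphic_map (suspension X) (suspension Y) h \<and>
     (\<forall>L \<in> flow_lines X. h ` L \<in> flow_lines Y) \<and> orientation_preserving X h)"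

lemma topspace_full_shift [simp]: "topspace full_shift = UNIV"
  by (simp add: full_shift_def)

lemma continuous_map_shift_pow: "continuous_map full_shift full_shift (shift_pow n)"
  unfolding full_shift_def shift_pow_def
  by (subst continuous_map_componentwise_UNIV) (intro allI continuous_map_product_projection UNIV_I)

lemma shift_pow_generated_subshift:
  assumes "y \<in> generated_subshift x"
  shows "shift_pow n y \<in> generated_subshift x"
proof -
  have "shift_pow n ` range (\<lambda>k. shift_pow k x) \<subseteq> range (\<lambda>k. shift_pow k x)"
    by (auto simp: shift_pow_add)
  then have "shift_pow n ` generated_subshift x \<subseteq> generated_subshift x"
    unfolding generated_subshift_def
    using continuous_map_image_closure_subset[OF continuous_map_shift_pow] closure_of_mono
    by (meson subset_trans)
  then show ?thesis using assms by blast
qed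

text \<open>The hypothesis holds for every generated subshift, by \<open>shift_pow_generated_subshift\<close>.\<close>

lemma equiv_suspension_rel:
  assumes "\<And>n x. x \<in> X \<Longrightarrow> shift_pow n x \<in> X"
  shows "equiv (X \<times> UNIV) (suspension_rel X)"
proof (rule equivI)
  show "suspension_rel X \<subseteq> (X \<times> UNIV) \<times> (X \<times> UNIV)"
    by (auto simp: suspension_rel_def)
  show "refl_on (X \<times> UNIV) (suspension_rel X)"
    by (auto simp: refl_on_def suspension_rel_def shift_pow_0 intro!: exI[of _ 0])
  show "sym (suspension_rel X)"
  proof (rule symI, clarify)
    fix x s y t assume "((x, s), (y, t)) \<in> suspension_rel X"
    then obtain n where "x \<in> X" "y \<in> X" "y = shift_pow n x" "t = s - of_int n"
      by (auto simp: suspension_rel_def)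
    then show "((y, t), (x, s)) \<in> suspension_rel X"
      by (auto simp: suspension_rel_def shift_pow_add shift_pow_0 intro!: exI[of _ "- n"])
  qed
  show "trans (suspension_rel X)"
  proof (rule transI, clarify)
    fix x s y t z u
    assume "((x, s), (y, t)) \<in> suspension_rel X" "((y, t), (z, u)) \<in> suspension_rel X"
    then obtain m n where "x \<in> X" "y = shift_pow m x" "t = s - of_int m"
      "z \<in> X" "z = shift_pow n y" "u = t - of_int n"
      by (auto simp: suspension_rel_def)
    then show "((x, s), (z, u)) \<in> suspension_rel X"
      by (auto simp: suspension_rel_def shift_pow_add intro!: exI[of _ "n + m"])
  qed
qed

lemma openin_suspension:
  "openin (suspension X) U \<longleftrightarrow> U \<subseteq> (X \<times> UNIV) // suspension_rel X \<and>
     openin (shift_cylinder X) {p \<in> X \<times> UNIV. suspension_class X p \<in> U}"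
proof -
  let ?pre = "\<lambda>U. {p \<in> X \<times> UNIV. suspension_class X p \<in> U}"
  let ?O = "\<lambda>U. U \<subseteq> (X \<times> UNIV) // suspension_rel X \<and> openin (shift_cylinder X) (?pre U)"
  have "istopology ?O"
    unfolding istopology_def
  proof (intro conjI allI impI)
    fix S T assume S: "?O S" and T: "?O T"
    show "S \<inter> T \<subseteq> (X \<times> UNIV) // suspension_rel X" using S by blast
    have "?pre (S \<inter> T) = ?pre S \<inter> ?pre T" by blast
    then show "openin (shift_cylinder X) (?pre (S \<inter> T))" using S T by (simp add: openin_Int)
  next
    fix K assume K: "\<forall>S\<in>K. ?O S"
    show "\<Union>K \<subseteq> (X \<times> UNIV) // suspension_rel X" using K by blast
    have "?pre (\<Union>K) = \<Union>(?pre ` K)" by blast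
    moreover have "openin (shift_cylinder X) (\<Union>(?pre ` K))"
      by (rule openin_Union) (use K in blast)
    ultimately show "openin (shift_cylinder X) (?pre (\<Union>K))" by simp
  qed
  then show ?thesis
    by (simp add: suspension_def topology_inverse')
qed

lemma topspace_suspension: "topspace (suspension X) = (X \<times> UNIV) // suspension_rel X"
proof -
  have "{p \<in> X \<times> UNIV. suspension_class X p \<in> (X \<times> UNIV) // suspension_rel X}
      = topspace (shift_cylinder X)"
    by (auto simp: suspension_class_def quotient_def)
  then have "openin (suspension X) ((X \<times> UNIV) // suspension_rel X)"
    using openin_topspace[of "shift_cylinder X"] by (simp only: openin_suspension order_refl simp_thms)
  moreover have "topspace (suspension X) \<subseteq> (X \<times> UNIV) // suspension_rel X"
    using openin_topspace[of "suspension X"] unfolding openin_suspension by (rule conjunct1)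
  ultimately show ?thesis
    by (intro subset_antisym) (auto dest: openin_subset)
qed

lemma quotient_map_suspension:
  "quotient_map (shift_cylinder X) (suspension X) (suspension_class X)"
  by (auto simp: quotient_map_def topspace_suspension openin_suspension
      suspension_class_def quotient_def)

lemma suspension_flow_class:
  "suspension_flow t (suspension_class X (x, s)) = suspension_class X (x, s + t)"
proof (intro equalityI subsetI)
  fix p assume "p \<in> suspension_flow t (suspension_class X (x, s))"
  then show "p \<in> suspension_class X (x, s + t)"
    by (force simp: suspension_flow_def suspension_class_def suspension_rel_def)
next
  fix p assume "p \<in> suspension_class X (x, s + t)"
  then obtain y n where "p = (y, s + t - of_int n)" "x \<in> X" "y \<in> X" "y = shift_pow n x"
    by (auto simp: suspension_class_def suspension_rel_def)
  then have "p = (\<lambda>(x, s). (x, s + t)) (y, s - of_int n)"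
    "(y, s - of_int n) \<in> suspension_class X (x, s)"
    by (auto simp: suspension_class_def suspension_rel_def)
  then show "p \<in> suspension_flow t (suspension_class X (x, s))"
    unfolding suspension_flow_def by blast
qed

end

theory Submission
  imports Defs
begin

text \<open>An eventually periodic \<open>x\<close> agrees far to the left with a periodic \<open>y\<close> of minimal period \<open>p\<close>
  and far to the right with \<open>y\<close> delayed by some \<open>c\<close>. The subshift of \<open>x\<close> therefore consists of the
  discrete orbit of \<open>x\<close> and the finite orbit of \<open>y\<close>, and its suspension is a circle of length \<open>p\<close>
  with one flow line spiralling towards it at both ends. For a second such sequence, with data \<open>y'\<close>,
  \<open>p'\<close>, \<open>c'\<close>, map \<open>[y, s]\<close> to \<open>[y', r s]\<close> with \<open>r = p' / p\<close>, and \<open>[x, s]\<close> to \<open>[x', \<tau> s]\<close>. This map is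
  continuous as soon as \<open>\<tau> s = r s\<close> near minus infinity and \<open>\<tau> s = r (s - c) + c'\<close> near plus infinity.
  Since \<open>c'\<close> matters only modulo \<open>p'\<close>, it can be taken at least \<open>r c\<close>, and then \<open>\<tau>\<close> can be
  chosen increasing. The inverse map has the same form, with \<open>\<tau>\<close> replaced by its inverse.\<close>

section \<open>Windows\<close>

text \<open>For fixed \<open>z\<close> the sets \<open>{w. agree L z w}\<close> form a neighbourhood
  base at \<open>z\<close>, so the topological arguments reduce to comparing central windows. A
  negative \<open>L\<close> imposes no condition.\<close>

definition agree :: "int \<Rightarrow> (int \<Rightarrow> 'a) \<Rightarrow> (int \<Rightarrow> 'a) \<Rightarrow> bool" where
  "agree L z w \<longleftrightarrow> (\<forall>i. \<bar>i\<bar> \<le> L \<longrightarrow> z i = w i)"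

lemma agree_refl [simp]: "agree L z z"
  by (simp add: agree_def)

lemma agree_sym: "agree L z w \<Longrightarrow> agree L w z"
  by (simp add: agree_def)

lemma agree_trans: "agree L z w \<Longrightarrow> agree L w u \<Longrightarrow> agree L z u"
  by (simp add: agree_def)

lemma agree_mono: "agree L z w \<Longrightarrow> K \<le> L \<Longrightarrow> agree K z w"
  by (simp add: agree_def)

text \<open>Each member of \<open>F\<close> differs from \<open>z\<close> at some position, and
  finitely many positions fit into one window.\<close>

lemma not_agree_finite:
  assumes "finite F" "z \<notin> F"
  shows "\<exists>L. \<forall>w\<in>F. \<not> agree L z w"
  using assms
proof (induction F rule: finite_induct)
  case empty
  then show ?case by simp
next
  case (insert u F)
  then obtain L where L: "\<forall>w\<in>F. \<not> agree L z w" by auto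
  obtain i where i: "z i \<noteq> u i" using insert.prems by auto
  then have "\<not> agree \<bar>i\<bar> z u" by (auto simp: agree_def)
  then have "\<forall>w\<in>insert u F. \<not> agree (max L \<bar>i\<bar>) z w"
    using L agree_mono max.cobounded1 max.cobounded2 by blast
  then show ?case by blast
qed

lemma not_agree_bounded:
  fixes M :: int
  assumes "\<And>m. \<bar>m\<bar> \<le> M \<Longrightarrow> z \<noteq> f m"
  obtains L where "\<And>m. \<bar>m\<bar> \<le> M \<Longrightarrow> \<not> agree L z (f m)"
proof -
  have "z \<notin> f ` {-M..M}"
  proof
    assume "z \<in> f ` {-M..M}"
    then obtain m where "- M \<le> m" "m \<le> M" "z = f m" by auto
    then show False using assms[of m] by simp
  qed
  then obtain L where "\<forall>w\<in>f ` {-M..M}. \<not> agree L z w"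
    using not_agree_finite[of "f ` {-M..M}" z] by auto
  then have "\<not> agree L z (f m)" if "\<bar>m\<bar> \<le> M" for m
    using that abs_le_D1 abs_le_D2 by fastforce
  then show thesis by (rule that)
qed

section \<open>Topologies described by windows\<close>

lemma openin_full_shift:
  "openin full_shift V \<longleftrightarrow> (\<forall>z\<in>V. \<exists>L. \<forall>w. agree L z w \<longrightarrow> w \<in> V)"
proof (intro iffI ballI)
  fix z assume "openin full_shift V" "z \<in> V"
  then obtain U where U: "finite {i. U i \<noteq> (UNIV :: 'a set)}" "z \<in> Pi\<^sub>E UNIV U" "Pi\<^sub>E UNIV U \<subseteq> V"
    unfolding full_shift_def openin_product_topology_alt by auto
  \<comment> \<open>A basic box constrains finitely many positions, and this window covers them.
    Inserting 0 keeps \<open>Max\<close> meaningful when none is constrained.\<close>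
  define L where "L = Max (insert 0 (abs ` {i. U i \<noteq> UNIV}))"
  have L: "\<bar>i\<bar> \<le> L" if "U i \<noteq> UNIV" for i
    unfolding L_def using U(1) that by (intro Max_ge) auto
  have "w \<in> V" if "agree L z w" for w
  proof -
    have "w i \<in> U i" for i
      using L[of i] U(2) that unfolding agree_def PiE_iff by (metis UNIV_I)
    then show ?thesis using U(3) by (auto simp: PiE_iff)
  qed
  then show "\<exists>L. \<forall>w. agree L z w \<longrightarrow> w \<in> V" by blast
next
  assume V: "\<forall>z\<in>V. \<exists>L. \<forall>w. agree L z w \<longrightarrow> w \<in> V"
  show "openin full_shift V"
    unfolding full_shift_def openin_product_topology_alt
  proof (intro ballI)
    fix z assume "z \<in> V"
    then obtain L where L: "\<And>w. agree L z w \<Longrightarrow> w \<in> V" using V by blast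
    define U where "U = (\<lambda>i. if \<bar>i\<bar> \<le> L then {z i} else UNIV)"
    have "{i. U i \<noteq> UNIV} \<subseteq> {-L..L}" by (auto simp: U_def)
    then have "finite {i. U i \<noteq> UNIV}" by (rule finite_subset) simp
    moreover have "Pi\<^sub>E UNIV U \<subseteq> V"
    proof
      fix w assume "w \<in> Pi\<^sub>E UNIV U"
      then have "w i \<in> U i" for i by (simp add: PiE_iff)
      then have "agree L z w" unfolding agree_def U_def by (metis singletonD)
      then show "w \<in> V" by (rule L)
    qed
    moreover have "z \<in> Pi\<^sub>E UNIV U" by (simp add: U_def PiE_iff)
    ultimately show "\<exists>U. finite {i \<in> UNIV. U i \<noteq> topspace (discrete_topology UNIV)} \<and>
        (\<forall>i\<in>UNIV. openin (discrete_topology UNIV) (U i)) \<and> z \<in> Pi\<^sub>E UNIV U \<and> Pi\<^sub>E UNIV U \<subseteq> V"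
      by (intro exI[of _ U]) simp
  qed
qed

lemma openin_full_shift_agree: "openin full_shift {w. agree L z w}"
  unfolding openin_full_shift using agree_trans by blast

lemma openin_shift_cylinder:
  "openin (shift_cylinder X) S \<longleftrightarrow> S \<subseteq> X \<times> UNIV \<and>
    (\<forall>(z, s)\<in>S. \<exists>L e. e > 0 \<and> (\<forall>w\<in>X. \<forall>t. agree L z w \<longrightarrow> \<bar>t - s\<bar> < e \<longrightarrow> (w, t) \<in> S))"
    (is "_ \<longleftrightarrow> _ \<and> ?R")
proof (intro iffI conjI)
  assume S: "openin (shift_cylinder X) S"
  then show sub: "S \<subseteq> X \<times> UNIV" using openin_subset by fastforce
  show ?R
  proof clarify
    fix z s assume "(z, s) \<in> S"
    then obtain U V where U: "openin full_shift U" and V: "open V"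
      and zs: "z \<in> X \<inter> U" "s \<in> V" and UV: "(X \<inter> U) \<times> V \<subseteq> S"
      using S unfolding openin_prod_topology_alt openin_subtopology
      by (metis Int_commute open_openin)
    obtain L where L: "\<And>w. agree L z w \<Longrightarrow> w \<in> U"
      using U zs unfolding openin_full_shift by blast
    obtain e where e: "e > 0" "\<And>t. \<bar>t - s\<bar> < e \<Longrightarrow> t \<in> V"
      using V zs unfolding open_dist dist_real_def by blast
    have "\<forall>w\<in>X. \<forall>t. agree L z w \<longrightarrow> \<bar>t - s\<bar> < e \<longrightarrow> (w, t) \<in> S"
      using L e(2) UV by blast
    then show "\<exists>L e. e > 0 \<and> (\<forall>w\<in>X. \<forall>t. agree L z w \<longrightarrow> \<bar>t - s\<bar> < e \<longrightarrow> (w, t) \<in> S)"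
      using e(1) by blast
  qed
next
  assume R: "S \<subseteq> X \<times> UNIV \<and> ?R"
  show "openin (shift_cylinder X) S"
    unfolding openin_prod_topology_alt
  proof (intro allI impI)
    fix z s assume zs: "(z, s) \<in> S"
    then obtain L e where e: "e > 0"
      and Le: "\<And>w t. w \<in> X \<Longrightarrow> agree L z w \<Longrightarrow> \<bar>t - s\<bar> < e \<Longrightarrow> (w, t) \<in> S"
      using R by blast
    let ?U = "{w. agree L z w} \<inter> X" and ?V = "ball s e"
    have "openin (subtopology full_shift X) ?U"
      using openin_full_shift_agree by (rule openin_subtopology_Int)
    moreover have "?U \<times> ?V \<subseteq> S"
      using Le by (auto simp: dist_real_def abs_minus_commute)
    moreover have "z \<in> ?U" "s \<in> ?V" using zs R e by auto
    ultimately show "\<exists>U V. openin (subtopology full_shift X) U \<and> openin euclideanreal V \<and>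
        z \<in> U \<and> s \<in> V \<and> U \<times> V \<subseteq> S"
      by (metis open_ball open_openin)
  qed
qed

lemma in_generated_subshift:
  "z \<in> generated_subshift x \<longleftrightarrow> (\<forall>L. \<exists>k. agree L z (shift_pow k x))"
proof -
  have iff: "z \<in> generated_subshift x \<longleftrightarrow>
      (\<forall>T. z \<in> T \<and> openin full_shift T \<longrightarrow> (\<exists>k. shift_pow k x \<in> T))"
    by (simp add: generated_subshift_def in_closure_of)
  show ?thesis
  proof (intro iffI allI)
    fix L assume "z \<in> generated_subshift x"
    then have "\<exists>k. shift_pow k x \<in> {w. agree L z w}"
      unfolding iff using openin_full_shift_agree[of L z] by (metis agree_refl mem_Collect_eq)
    then show "\<exists>k. agree L z (shift_pow k x)" by simp
  next
    assume *: "\<forall>L. \<exists>k. agree L z (shift_pow k x)"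
    have "\<exists>k. shift_pow k x \<in> T" if T: "z \<in> T" "openin full_shift T" for T
    proof -
      obtain L where "\<And>w. agree L z w \<Longrightarrow> w \<in> T"
        using T unfolding openin_full_shift by blast
      then show ?thesis using * by blast
    qed
    then show "z \<in> generated_subshift x" unfolding iff by blast
  qed
qed

section \<open>Suspension classes and their neighbourhoods\<close>

lemma shift_pow_eq_iff: "shift_pow j z = shift_pow k z \<longleftrightarrow> shift_pow (j - k) z = z"
  by (metis add.commute diff_add_cancel diff_self shift_pow_0 shift_pow_add uminus_add_conv_diff)

lemma suspension_class_eq_iff:
  assumes "z \<in> generated_subshift x" "w \<in> generated_subshift x"
  shows "suspension_class (generated_subshift x) (z, s) = suspension_class (generated_subshift x) (w, t)
    \<longleftrightarrow> (\<exists>n. w = shift_pow n z \<and> t = s - of_int n)"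
  unfolding suspension_class_def
  using eq_equiv_class_iff[OF equiv_suspension_rel[OF shift_pow_generated_subshift], of x "(z, s)" "(w, t)"]
    assms by (simp add: suspension_rel_def)

lemma suspension_class_shift_pow:
  assumes "z \<in> generated_subshift x"
  shows "suspension_class (generated_subshift x) (shift_pow k z, s) =
    suspension_class (generated_subshift x) (z, s + of_int k)"
  using suspension_class_eq_iff[OF assms shift_pow_generated_subshift[OF assms], of "s + of_int k" k s]
  by auto

text \<open>Openness in the quotient is openness of the preimage in the cylinder, so a neighbourhood
  can be taken around any convenient representative of a class.\<close>

lemma openin_suspension_nhd:
  assumes "openin (suspension X) U" "suspension_class X (z, s) \<in> U" "z \<in> X"
  obtains L e where "e > 0"
    "\<And>w t. w \<in> X \<Longrightarrow> agree L z w \<Longrightarrow> \<bar>t - s\<bar> < e \<Longrightarrow> suspension_class X (w, t) \<in> U"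
proof -
  have "openin (shift_cylinder X) {p \<in> X \<times> UNIV. suspension_class X p \<in> U}"
    using assms(1) openin_suspension by blast
  moreover have "(z, s) \<in> {p \<in> X \<times> UNIV. suspension_class X p \<in> U}"
    using assms by simp
  ultimately obtain L e where "e > 0" "\<forall>w\<in>X. \<forall>t. agree L z w \<longrightarrow> \<bar>t - s\<bar> < e \<longrightarrow>
      (w, t) \<in> {p \<in> X \<times> UNIV. suspension_class X p \<in> U}"
    unfolding openin_shift_cylinder by blast
  then show thesis by (intro that[of e L]) auto
qed


section \<open>Sequences homoclinic to a periodic orbit\<close>

text \<open>The orbit of \<open>x\<close> is asymptotic to the orbit of \<open>y\<close> in both
  directions, and \<open>c\<close> is the phase lag picked up in between. The equivalence in
  \<open>period\<close> makes \<open>p\<close> the least period of \<open>y\<close>.\<close>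

locale homoclinic =
  fixes x y :: "int \<Rightarrow> 'a" and p c :: int
  assumes p_pos: "0 < p"
    and period: "shift_pow m y = y \<longleftrightarrow> p dvd m"
    and not_periodic: "\<not> periodic x"
    and left_tail: "\<exists>a. \<forall>k\<le>a. x k = y k"
    and right_tail: "\<exists>b. \<forall>k\<ge>b. x k = y (k - c)"
begin

lemma shift_y_eq_iff: "shift_pow j y = shift_pow k y \<longleftrightarrow> p dvd j - k"
  by (simp add: shift_pow_eq_iff[of j] period)

lemma shift_x_eq_iff: "shift_pow j x = shift_pow k x \<longleftrightarrow> j = k"
proof
  assume "shift_pow j x = shift_pow k x"
  \<comment> \<open>\<open>periodic\<close> asks for a positive shift; if \<open>j\<close> and
    \<open>k\<close> differ, one of the two differences is positive.\<close>
  then have "shift_pow (j - k) x = x" "shift_pow (k - j) x = x"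
    using shift_pow_eq_iff by metis+
  then show "j = k"
    using not_periodic unfolding periodic_def by (metis diff_gt_0_iff_gt linorder_neqE)
qed simp

text \<open>Otherwise \<open>x\<close> would inherit the period \<open>p\<close> of
  \<open>y\<close>.\<close>

lemma shift_x_neq_shift_y: "shift_pow j x \<noteq> shift_pow k y"
proof
  assume eq: "shift_pow j x = shift_pow k y"
  have "shift_pow (j + p) x = shift_pow p (shift_pow j x)"
    by (simp add: shift_pow_add add.commute)
  also have "\<dots> = shift_pow (p + k) y" by (simp add: eq shift_pow_add)
  also have "\<dots> = shift_pow j x" by (simp add: eq shift_y_eq_iff)
  finally show False using p_pos by (simp add: shift_x_eq_iff)
qed

lemma finite_orbit_y: "finite (range (\<lambda>k. shift_pow k y))"
proof -
  have "shift_pow k y = shift_pow (k mod p) y" for k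
    by (simp add: shift_y_eq_iff minus_mod_eq_mult_div)
  moreover have "k mod p \<in> {0..<p}" for k
    using p_pos by simp
  ultimately have "range (\<lambda>k. shift_pow k y) \<subseteq> (\<lambda>k. shift_pow k y) ` {0..<p}"
    by blast
  then show ?thesis by (rule finite_subset) simp
qed

text \<open>For large \<open>\<bar>m\<bar>\<close> the window around position \<open>m\<close> lies
  wholly inside one of the two tails. Hence the orbit of \<open>x\<close> accumulates on that of
  \<open>y\<close> at both ends.\<close>

lemma agree_tails:
  "\<exists>M. \<forall>m. (m \<le> - M \<longrightarrow> agree L (shift_pow m x) (shift_pow m y)) \<and>
    (M \<le> m \<longrightarrow> agree L (shift_pow m x) (shift_pow (m - c) y))"
proof -
  obtain a b where a: "\<And>k. k \<le> a \<Longrightarrow> x k = y k" and b: "\<And>k. b \<le> k \<Longrightarrow> x k = y (k - c)"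
    using left_tail right_tail by blast
  have "agree L (shift_pow m x) (shift_pow m y)" if "m \<le> - max (L - a) (L + b)" for m
    unfolding agree_def shift_pow_def
  proof (intro allI impI a)
    fix i assume "\<bar>i\<bar> \<le> L"
    then show "i + m \<le> a" using that by linarith
  qed
  moreover have "agree L (shift_pow m x) (shift_pow (m - c) y)" if m: "max (L - a) (L + b) \<le> m" for m
    unfolding agree_def shift_pow_def
  proof (intro allI impI)
    fix i assume "\<bar>i\<bar> \<le> L"
    then have "b \<le> i + m" using m by linarith
    then show "x (i + m) = y (i + (m - c))" using b by (simp add: add_diff_eq)
  qed
  ultimately show ?thesis by blast
qed

text \<open>One window separates \<open>z\<close> from the finite orbit of \<open>y\<close>. In that
  window all far shifts of \<open>x\<close> look like shifts of \<open>y\<close>, so none of them is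
  close to \<open>z\<close>.\<close>

lemma agree_shift_x_bounded:
  assumes "\<And>k. z \<noteq> shift_pow k y"
  shows "\<exists>L M. \<forall>m. agree L z (shift_pow m x) \<longrightarrow> \<bar>m\<bar> \<le> M"
proof -
  obtain L where L: "\<And>k. \<not> agree L z (shift_pow k y)"
    using not_agree_finite[OF finite_orbit_y, of z] assms by blast
  obtain M where "\<And>m. m \<le> - M \<Longrightarrow> agree L (shift_pow m x) (shift_pow m y)"
    "\<And>m. M \<le> m \<Longrightarrow> agree L (shift_pow m x) (shift_pow (m - c) y)"
    using agree_tails by blast
  then have "\<bar>m\<bar> \<le> M" if "agree L z (shift_pow m x)" for m
    using L agree_trans[OF that] by (metis abs_le_iff linorder_le_cases minus_le_iff)
  then show ?thesis by blast
qed

text \<open>A limit point outside both orbits is close to boundedly many shifts of \<open>x\<close>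
  only, and a larger window excludes these as well. Conversely, shifts of \<open>y\<close> are
  limits of shifts of \<open>x\<close> far to the left.\<close>

lemma generated_subshift_eq:
  "generated_subshift x = range (\<lambda>k. shift_pow k x) \<union> range (\<lambda>k. shift_pow k y)"
proof (intro equalityI subsetI)
  fix z assume z: "z \<in> generated_subshift x"
  show "z \<in> range (\<lambda>k. shift_pow k x) \<union> range (\<lambda>k. shift_pow k y)"
  proof (rule ccontr)
    assume nz: "z \<notin> range (\<lambda>k. shift_pow k x) \<union> range (\<lambda>k. shift_pow k y)"
    then obtain L M where L: "\<And>m. agree L z (shift_pow m x) \<Longrightarrow> \<bar>m\<bar> \<le> M"
      using agree_shift_x_bounded[of z] by blast
    obtain K where K: "\<And>m. \<bar>m\<bar> \<le> M \<Longrightarrow> \<not> agree K z (shift_pow m x)"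
      using not_agree_bounded[of M z "\<lambda>m. shift_pow m x"] nz by blast
    obtain m where "agree (max L K) z (shift_pow m x)"
      using z in_generated_subshift by blast
    then have "agree L z (shift_pow m x)" "agree K z (shift_pow m x)"
      by (auto intro: agree_mono)
    then show False using L K by blast
  qed
next
  fix z assume "z \<in> range (\<lambda>k. shift_pow k x) \<union> range (\<lambda>k. shift_pow k y)"
  then show "z \<in> generated_subshift x"
  proof
    assume "z \<in> range (\<lambda>k. shift_pow k x)"
    then show ?thesis unfolding in_generated_subshift using agree_refl by blast
  next
    assume "z \<in> range (\<lambda>k. shift_pow k y)"
    then obtain k where k: "z = shift_pow k y" by blast
    show ?thesis unfolding in_generated_subshift
    proof
      fix L
      obtain M where M: "\<And>m. m \<le> - M \<Longrightarrow> agree L (shift_pow m x) (shift_pow m y)"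
        using agree_tails by blast
      \<comment> \<open>Subtracting a multiple of \<open>p\<close> does not change the shift of
        \<open>y\<close>, and as \<open>p\<close> is at least 1 this multiple is large enough to
        reach the left tail.\<close>
      define m where "m = k - p * (\<bar>k\<bar> + \<bar>M\<bar>)"
      have "\<bar>k\<bar> + \<bar>M\<bar> \<le> p * (\<bar>k\<bar> + \<bar>M\<bar>)"
        using p_pos mult_right_mono[of 1 p "\<bar>k\<bar> + \<bar>M\<bar>"] by simp
      then have "m \<le> - M" by (simp add: m_def)
      moreover have "shift_pow m y = z" by (simp add: k m_def shift_y_eq_iff)
      ultimately show "\<exists>m. agree L z (shift_pow m x)" using M agree_sym by metis
    qed
  qed
qed

lemma x_in: "x \<in> generated_subshift x"
  using generated_subshift_eq shift_pow_0 by (metis UnI1 rangeI)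

lemma y_in: "y \<in> generated_subshift x"
  using generated_subshift_eq shift_pow_0 by (metis UnI2 rangeI)

text \<open>A window that leaves only finitely many shifts of \<open>x\<close> near
  \<open>?z\<close> is enlarged to exclude these, except \<open>?z\<close> itself, and the finite
  orbit of \<open>y\<close>.\<close>

lemma shift_x_isolated:
  "\<exists>L. \<forall>w\<in>generated_subshift x. agree L (shift_pow k x) w \<longrightarrow> w = shift_pow k x"
proof -
  let ?z = "shift_pow k x"
  obtain L M where L: "\<And>m. agree L ?z (shift_pow m x) \<Longrightarrow> \<bar>m\<bar> \<le> M"
    using agree_shift_x_bounded[OF shift_x_neq_shift_y] by blast
  obtain K where K: "\<And>w. w \<in> (\<lambda>m. shift_pow m x) ` {-M..M} - {?z} \<union> range (\<lambda>k. shift_pow k y)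
      \<Longrightarrow> \<not> agree K ?z w"
    using not_agree_finite[of "(\<lambda>m. shift_pow m x) ` {-M..M} - {?z} \<union> range (\<lambda>k. shift_pow k y)" ?z]
      finite_orbit_y shift_x_neq_shift_y by blast
  have "w = ?z" if w: "w \<in> generated_subshift x" and ag: "agree (max L K) ?z w" for w
  proof (rule ccontr)
    assume ne: "w \<noteq> ?z"
    have "agree L ?z w" "agree K ?z w" using ag by (auto intro: agree_mono)
    moreover from this(2) K have "w \<notin> range (\<lambda>k. shift_pow k y)" by blast
    then obtain m where m: "w = shift_pow m x" using w generated_subshift_eq by blast
    ultimately have "m \<in> {-M..M}" using L[of m] by auto
    then have "w \<in> (\<lambda>m. shift_pow m x) ` {-M..M} - {?z}" using m ne by blast
    then show False using K \<open>agree K ?z w\<close> by blast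
  qed
  then show ?thesis by blast
qed

text \<open>This describes how the line of \<open>x\<close> spirals towards the circle of
  \<open>y\<close>. The window \<open>L\<close> distinguishes the finitely many shifts of
  \<open>y\<close>, so a far shift of \<open>x\<close> that is close to \<open>?z\<close> must have
  the right phase modulo \<open>p\<close>; the window \<open>K\<close> rules out the near shifts of
  \<open>x\<close>.\<close>

lemma neighbours_shift_y:
  "\<exists>L. \<forall>w\<in>generated_subshift x. agree L (shift_pow k y) w \<longrightarrow> w = shift_pow k y \<or>
    (\<exists>m\<le>- M. w = shift_pow m x \<and> p dvd m - k) \<or> (\<exists>m\<ge>M. w = shift_pow m x \<and> p dvd m - c - k)"
proof -
  let ?z = "shift_pow k y"
  obtain L where L: "\<And>j. agree L ?z (shift_pow j y) \<Longrightarrow> shift_pow j y = ?z"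
    using not_agree_finite[of "range (\<lambda>k. shift_pow k y) - {?z}" ?z] finite_orbit_y by blast
  obtain M0 where M0: "\<And>m. m \<le> - M0 \<Longrightarrow> agree L (shift_pow m x) (shift_pow m y)"
    "\<And>m. M0 \<le> m \<Longrightarrow> agree L (shift_pow m x) (shift_pow (m - c) y)"
    using agree_tails by blast
  define N where "N = max M M0"
  obtain K where K: "\<And>m. \<bar>m\<bar> \<le> N \<Longrightarrow> \<not> agree K ?z (shift_pow m x)"
    using not_agree_bounded[of N ?z "\<lambda>m. shift_pow m x"] shift_x_neq_shift_y by metis
  have "w = ?z \<or> (\<exists>m\<le>- M. w = shift_pow m x \<and> p dvd m - k) \<or>
      (\<exists>m\<ge>M. w = shift_pow m x \<and> p dvd m - c - k)"
    if w: "w \<in> generated_subshift x" and ag: "agree (max L K) ?z w" for w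
  proof -
    have aL: "agree L ?z w" and aK: "agree K ?z w" using ag by (auto intro: agree_mono)
    consider j where "w = shift_pow j y" | m where "w = shift_pow m x"
      using w generated_subshift_eq by blast
    then show ?thesis
    proof cases
      case 1
      then show ?thesis using aL L by blast
    next
      case (2 m)
      then have "\<not> \<bar>m\<bar> \<le> N" using aK K by blast
      then consider "m \<le> - N" | "N \<le> m" by linarith
      then show ?thesis
      proof cases
        case 1
        then have "agree L w (shift_pow m y)" using M0(1)[of m] 2 by (simp add: N_def)
        then have "p dvd m - k" using L[of m] agree_trans[OF aL] shift_y_eq_iff by blast
        then show ?thesis using 1 2 by (auto simp: N_def)
      next
        case left: 2
        then have "agree L w (shift_pow (m - c) y)" using M0(2)[of m] 2 by (simp add: N_def)
        then have "p dvd m - c - k" using L[of "m - c"] agree_trans[OF aL] shift_y_eq_iff by blast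
        then show ?thesis using left 2 by (auto simp: N_def)
      qed
    qed
  qed
  then show ?thesis by blast
qed

section \<open>Coordinates on the suspension: a line for \<open>x\<close> and a circle of length
  \<open>p\<close> for \<open>y\<close>\<close>

abbreviation cls :: "(int \<Rightarrow> 'a) \<times> real \<Rightarrow> ((int \<Rightarrow> 'a) \<times> real) set" where
  "cls \<equiv> suspension_class (generated_subshift x)"

lemma cls_x_eq_iff: "cls (x, s) = cls (x, t) \<longleftrightarrow> s = t"
  using suspension_class_eq_iff[OF x_in x_in, of s t] shift_x_eq_iff[of 0]
  by (auto simp: shift_pow_0 intro!: exI[of _ 0])

lemma cls_x_neq_cls_y: "cls (x, s) \<noteq> cls (y, t)"
  using suspension_class_eq_iff[OF x_in y_in, of s t] shift_x_neq_shift_y[of _ 0]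
  by (auto simp: shift_pow_0)

lemma cls_y_eq_iff: "cls (y, s) = cls (y, t) \<longleftrightarrow> (\<exists>j. t = s + of_int (p * j))"
proof -
  have "cls (y, s) = cls (y, t) \<longleftrightarrow> (\<exists>n. y = shift_pow n y \<and> t = s - of_int n)"
    by (rule suspension_class_eq_iff[OF y_in y_in])
  also have "\<dots> \<longleftrightarrow> (\<exists>n. p dvd n \<and> t = s - of_int n)"
    by (simp add: period eq_commute[of y])
  also have "\<dots> \<longleftrightarrow> (\<exists>j. t = s + of_int (p * j))"
  proof
    assume "\<exists>n. p dvd n \<and> t = s - of_int n"
    then obtain j where "t = s - of_int (p * j)" by (metis dvdE)
    then show "\<exists>j. t = s + of_int (p * j)" by (intro exI[of _ "- j"]) simp
  next
    assume "\<exists>j. t = s + of_int (p * j)"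
    then obtain j where "t = s + of_int (p * j)" by blast
    then show "\<exists>n. p dvd n \<and> t = s - of_int n" by (intro exI[of _ "- (p * j)"]) simp
  qed
  finally show ?thesis .
qed

lemma cls_shift_x: "cls (shift_pow k x, s) = cls (x, s + of_int k)"
  by (rule suspension_class_shift_pow[OF x_in])

lemma cls_shift_y: "cls (shift_pow k y, s) = cls (y, s + of_int k)"
  by (rule suspension_class_shift_pow[OF y_in])

text \<open>The shift in a representative is absorbed into the real coordinate, so two base points
  \<open>x\<close> and \<open>y\<close> suffice.\<close>

lemma topspace_cases:
  assumes "P \<in> topspace (suspension (generated_subshift x))"
  obtains s where "P = cls (x, s)" | s where "P = cls (y, s)"
proof -
  obtain z s where "z \<in> generated_subshift x" "P = cls (z, s)"
    using assms unfolding topspace_suspension suspension_class_def by (auto elim!: quotientE)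
  then show thesis using that cls_shift_x cls_shift_y generated_subshift_eq by auto
qed

lemma cls_in_topspace:
  assumes "z \<in> generated_subshift x"
  shows "cls (z, s) \<in> topspace (suspension (generated_subshift x))"
  unfolding topspace_suspension suspension_class_def using assms by (auto intro: quotientI)

text \<open>The lag matters only modulo the period. This freedom later makes the reparametrisation
  increasing.\<close>

lemma homoclinic_add_period: "homoclinic x y p (c + p * j)"
proof
  have "y (k - (c + p * j)) = y (k - c)" for k
    using fun_cong[OF iffD2[OF shift_y_eq_iff[of "- (p * j)" 0]], of "k - c"]
    by (simp add: shift_pow_def algebra_simps)
  then show "\<exists>b. \<forall>k\<ge>b. x k = y (k - (c + p * j))" using right_tail by simp
qed (use p_pos period not_periodic left_tail in auto)

end

text \<open>Take for \<open>y\<close> the sequence left after removing the word: the part before the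
  word stays, the part after it moves left by \<open>n\<close>, so the lag is \<open>n\<close>. For
  the period take the least one, \<open>q\<close>.\<close>

lemma eventually_periodic_homoclinic:
  assumes "eventually_periodic x"
  obtains y p c where "homoclinic x y p c"
proof -
  obtain i n where n: "n > 0" and per: "periodic (remove_word i n x)"
    using assms unfolding eventually_periodic_def by blast
  define y where "y = remove_word i n x"
  define q where "q = (LEAST N::nat. 0 < N \<and> shift_pow (int N) y = y)"
  obtain N where N: "N > 0" "shift_pow N y = y" using per unfolding periodic_def y_def by blast
  then have "\<exists>N::nat. 0 < N \<and> shift_pow (int N) y = y"
    by (intro exI[of _ "nat N"]) simp
  then have "0 < q \<and> shift_pow (int q) y = y"
    unfolding q_def by (rule LeastI_ex)
  then have q: "0 < q" "shift_pow (int q) y = y" by auto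
  have mult: "shift_pow (int q * k) y = y" for k
  proof (induction k rule: int_induct[of _ 0])
    case base
    then show ?case by (simp add: shift_pow_0)
  next
    case (step1 k)
    have "shift_pow (int q * (k + 1)) y = shift_pow (int q * k) (shift_pow (int q) y)"
      by (simp add: shift_pow_add distrib_left)
    then show ?case using q(2) step1 by simp
  next
    case (step2 k)
    have "shift_pow (int q * (k - 1)) y = shift_pow (int q * (k - 1)) (shift_pow (int q) y)"
      using q(2) by simp
    also have "\<dots> = shift_pow (int q * k) y"
      by (simp add: shift_pow_add right_diff_distrib)
    finally show ?case using step2 by simp
  qed
  have "homoclinic x y (int q) n"
  proof
    show "0 < int q" using q by simp
    show "shift_pow m y = y \<longleftrightarrow> int q dvd m" for m
    proof
      assume m: "shift_pow m y = y"
      \<comment> \<open>The remainder modulo \<open>q\<close> is again a period and is smaller than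
        \<open>q\<close>, so by minimality it is 0.\<close>
      have "shift_pow (m mod int q) y = shift_pow (m mod int q) (shift_pow (int q * (m div int q)) y)"
        by (simp add: mult)
      then have "shift_pow (m mod int q) y = y" by (simp add: shift_pow_add m)
      moreover have "m mod int q < int q" "0 \<le> m mod int q" using q by simp_all
      ultimately have "\<not> 0 < nat (m mod int q)"
        using not_less_Least[of "nat (m mod int q)" "\<lambda>N. 0 < N \<and> shift_pow (int N) y = y"]
        by (fold q_def) auto
      then show "int q dvd m" using \<open>0 \<le> m mod int q\<close> by (simp add: dvd_eq_mod_eq_0)
    next
      assume "int q dvd m"
      then show "shift_pow m y = y" using mult by (metis dvdE)
    qed
    show "\<not> periodic x" using assms unfolding eventually_periodic_def by blast
    show "\<exists>a. \<forall>k\<le>a. x k = y k" by (intro exI[of _ i]) (simp add: y_def remove_word_def)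
    show "\<exists>b. \<forall>k\<ge>b. x k = y (k - n)"
      \<comment> \<open>This is the first position after the removed word; from there on
        \<open>k - n\<close> exceeds \<open>i\<close>.\<close>
      by (intro exI[of _ "i + n + 1"]) (auto simp: y_def remove_word_def)
  qed
  then show thesis by (rule that)
qed


section \<open>Flow equivalence\<close>

locale homoclinic_pair = L: homoclinic x y p c + R: homoclinic x' y' p' c'
  for x y :: "int \<Rightarrow> 'a" and p c and x' y' :: "int \<Rightarrow> 'b" and p' c'
begin

text \<open>The factor that stretches the circle of length \<open>p\<close> onto the circle of
  length \<open>p'\<close>.\<close>

definition slope :: real where "slope = of_int p' / of_int p"

lemma slope_pos: "slope > 0"
  using L.p_pos R.p_pos by (simp add: slope_def)

lemma slope_mult_period: "of_int (p * j) * slope = of_int (p' * j)"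
  using L.p_pos by (simp add: slope_def)

lemma exists_map:
  "\<exists>h. (\<forall>s. h (L.cls (x, s)) = R.cls (x', \<tau> s)) \<and> (\<forall>s. h (L.cls (y, s)) = R.cls (y', s * slope))"
proof -
  \<comment> \<open>The coordinate on the line is unique, so \<open>THE\<close> recovers it. On the
    circle \<open>SOME\<close> picks a coordinate up to a multiple of \<open>p\<close>, which
    \<open>slope\<close> turns into a multiple of \<open>p'\<close>.\<close>
  define h where "h P = (if \<exists>s. P = L.cls (x, s) then R.cls (x', \<tau> (THE s. P = L.cls (x, s)))
    else R.cls (y', (SOME s. P = L.cls (y, s)) * slope))" for P
  have "h (L.cls (x, s)) = R.cls (x', \<tau> s)" for s
    by (auto simp: h_def L.cls_x_eq_iff)
  moreover have "h (L.cls (y, s)) = R.cls (y', s * slope)" for s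
  proof -
    define t where "t = (SOME t. L.cls (y, s) = L.cls (y, t))"
    have "L.cls (y, s) = L.cls (y, t)" unfolding t_def by (rule someI) simp
    then obtain j where "t = s + of_int (p * j)" using L.cls_y_eq_iff by blast
    then have "t * slope = s * slope + of_int (p' * j)"
      by (simp only: distrib_right slope_mult_period)
    then have "R.cls (y', s * slope) = R.cls (y', t * slope)" using R.cls_y_eq_iff by blast
    moreover have "h (L.cls (y, s)) = R.cls (y', t * slope)"
      using L.cls_x_neq_cls_y[of _ s] by (auto simp: h_def t_def dest: sym)
    ultimately show ?thesis by simp
  qed
  ultimately show ?thesis by blast
qed

text \<open>By the universal property of the quotient, continuity is checked on the cylinder. At
  points of the line the sequence is isolated, so continuity of \<open>\<tau>\<close> suffices. Near
  the circle, points of the line have parameters so far out that \<open>\<tau>\<close> is affine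
  there, and its two affine pieces match the phases of the tails of \<open>x\<close> and
  \<open>x'\<close>.\<close>

lemma continuous_map_suspension:
  assumes \<tau>: "continuous_on UNIV \<tau>"
    and \<tau>_left: "\<And>s. s \<le> A \<Longrightarrow> \<tau> s = s * slope"
    and \<tau>_right: "\<And>s. B \<le> s \<Longrightarrow> \<tau> s = (s - of_int c) * slope + of_int c'"
    and hx: "\<And>s. h (L.cls (x, s)) = R.cls (x', \<tau> s)"
    and hy: "\<And>s. h (L.cls (y, s)) = R.cls (y', s * slope)"
  shows "continuous_map (suspension (generated_subshift x)) (suspension (generated_subshift x')) h"
proof (rule continuous_compose_quotient_map[OF quotient_map_suspension])
  let ?X = "generated_subshift x" and ?X' = "generated_subshift x'"
  have "h P \<in> topspace (suspension ?X')" if "P \<in> topspace (suspension ?X)" for P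
    using L.topspace_cases[OF that] hx hy R.cls_in_topspace R.x_in R.y_in by metis
  moreover have "openin (shift_cylinder ?X) {p \<in> ?X \<times> UNIV. h (L.cls p) \<in> U}"
    if U: "openin (suspension ?X') U" for U
    unfolding openin_shift_cylinder
  proof (intro conjI)
    show "\<forall>(z, s)\<in>{p \<in> ?X \<times> UNIV. h (L.cls p) \<in> U}. \<exists>L e. e > 0 \<and> (\<forall>w\<in>?X. \<forall>t.
        agree L z w \<longrightarrow> \<bar>t - s\<bar> < e \<longrightarrow> (w, t) \<in> {p \<in> ?X \<times> UNIV. h (L.cls p) \<in> U})"
    proof clarify
      fix z s assume z: "z \<in> ?X" and hU: "h (L.cls (z, s)) \<in> U"
      have "\<exists>L e. e > 0 \<and> (\<forall>w\<in>?X. \<forall>t. agree L z w \<longrightarrow> \<bar>t - s\<bar> < e \<longrightarrow> h (L.cls (w, t)) \<in> U)"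
      proof -
        consider k where "z = shift_pow k x" | k where "z = shift_pow k y"
          using z L.generated_subshift_eq by blast
        then show ?thesis
        proof cases
          case k: (1 k)
          then have "R.cls (x', \<tau> (s + of_int k)) \<in> U" using hU by (simp add: L.cls_shift_x hx)
          then obtain e where e: "e > 0" "\<And>t. \<bar>t - \<tau> (s + of_int k)\<bar> < e \<Longrightarrow> R.cls (x', t) \<in> U"
            using openin_suspension_nhd[OF U _ R.x_in] R.x_in agree_refl by metis
          obtain d where d: "d > 0" "\<And>t. \<bar>t - (s + of_int k)\<bar> < d \<Longrightarrow> \<bar>\<tau> t - \<tau> (s + of_int k)\<bar> < e"
            using \<tau> e(1) unfolding continuous_on_iff dist_real_def by (metis UNIV_I)
          obtain L where L: "\<And>w. w \<in> ?X \<Longrightarrow> agree L z w \<Longrightarrow> w = z"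
            using L.shift_x_isolated[of k] k by blast
          have "h (L.cls (w, t)) \<in> U" if "w \<in> ?X" "agree L z w" "\<bar>t - s\<bar> < d" for w t
          proof -
            have "w = shift_pow k x" using L that k by blast
            moreover have "R.cls (x', \<tau> (t + of_int k)) \<in> U"
              using that by (intro e d) simp
            ultimately show ?thesis by (simp add: L.cls_shift_x hx)
          qed
          then show ?thesis using d(1) by blast
        next
          case k: (2 k)
          then have "R.cls (y', (s + of_int k) * slope) \<in> U" using hU by (simp add: L.cls_shift_y hy)
          then obtain L e where e: "e > 0"
            and Le: "\<And>w t. w \<in> ?X' \<Longrightarrow> agree L y' w \<Longrightarrow> \<bar>t - (s + of_int k) * slope\<bar> < e \<Longrightarrow> R.cls (w, t) \<in> U"
            by (rule openin_suspension_nhd[OF U _ R.y_in]) blast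
          \<comment> \<open>The bound \<open>e / slope\<close> controls the stretched coordinate;
            the bound 1 keeps \<open>t\<close> near \<open>s\<close>, as the choice of
            \<open>M\<close> requires.\<close>
          define d where "d = min 1 (e / slope)"
          have d: "d > 0" "d \<le> 1" using e slope_pos by (auto simp: d_def)
          have near: "\<bar>(t + of_int k) * slope - (s + of_int k) * slope\<bar> < e" if "\<bar>t - s\<bar> < d" for t
          proof -
            have "\<bar>(t + of_int k) * slope - (s + of_int k) * slope\<bar> = \<bar>t - s\<bar> * slope"
              using slope_pos by (simp add: abs_mult flip: left_diff_distrib)
            also have "\<dots> < e" using that slope_pos by (simp add: d_def pos_less_divide_eq)
            finally show ?thesis .
          qed
          obtain M' where M'_left: "\<And>m. m \<le> - M' \<Longrightarrow> agree L (shift_pow m x') (shift_pow m y')"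
            and M'_right: "\<And>m. M' \<le> m \<Longrightarrow> agree L (shift_pow m x') (shift_pow (m - c') y')"
            using R.agree_tails by blast
          \<comment> \<open>Once \<open>p' * j\<close> is at most \<open>- K\<close> or at least
            \<open>K\<close>, the shifts of \<open>x'\<close> by \<open>p' * j\<close> or
            \<open>p' * j + c'\<close>, respectively, are in the left or right tail.\<close>
          define K where "K = \<bar>M'\<bar> + \<bar>c'\<bar>"
          have K: "K \<le> p' * j" if "p * K \<le> p * j" for j
          proof -
            have "K \<le> j" using that L.p_pos by simp
            moreover have "0 \<le> K" by (simp add: K_def)
            ultimately show ?thesis using R.p_pos mult_mono[of 1 p' K j] by simp
          qed
          \<comment> \<open>The integer terms force the multiple \<open>j\<close> of the period in
            \<open>m\<close> to be at least \<open>K\<close> in absolute value; the ceiling pushes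
            \<open>t + of_int m\<close> below \<open>A\<close> or above \<open>B\<close>.\<close>
          define M where "M = p * K + \<bar>k\<bar> + \<bar>c\<bar> + \<lceil>\<bar>s\<bar> + 1 + \<bar>A\<bar> + \<bar>B\<bar>\<rceil>"
          have ceil: "\<bar>s\<bar> + 1 + \<bar>A\<bar> + \<bar>B\<bar> \<le> of_int \<lceil>\<bar>s\<bar> + 1 + \<bar>A\<bar> + \<bar>B\<bar>\<rceil>"
            by (rule le_of_int_ceiling)
          then have ceil_nonneg: "0 \<le> \<lceil>\<bar>s\<bar> + 1 + \<bar>A\<bar> + \<bar>B\<bar>\<rceil>" by simp
          have pK: "0 \<le> p * K" using L.p_pos by (simp add: K_def)
          have M: "p * K + \<bar>k\<bar> + \<bar>c\<bar> \<le> M" using ceil_nonneg by (simp add: M_def)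
          have "\<lceil>\<bar>s\<bar> + 1 + \<bar>A\<bar> + \<bar>B\<bar>\<rceil> \<le> M" using pK by (simp add: M_def)
          then have M_real: "\<bar>s\<bar> + 1 + \<bar>A\<bar> + \<bar>B\<bar> \<le> of_int M" using ceil by linarith
          obtain N where N: "\<And>w. w \<in> ?X \<Longrightarrow> agree N z w \<Longrightarrow> w = z \<or>
              (\<exists>m\<le>- M. w = shift_pow m x \<and> p dvd m - k) \<or> (\<exists>m\<ge>M. w = shift_pow m x \<and> p dvd m - c - k)"
            using L.neighbours_shift_y[of k M] k by blast
          have "h (L.cls (w, t)) \<in> U" if w: "w \<in> ?X" "agree N z w" and t: "\<bar>t - s\<bar> < d" for w t
          proof -
            have t1: "\<bar>t - s\<bar> < 1" using t d by linarith
            consider "w = z" | m where "m \<le> - M" "w = shift_pow m x" "p dvd m - k"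
              | m where "M \<le> m" "w = shift_pow m x" "p dvd m - c - k"
              using N[OF w] by blast
            then show ?thesis
            proof cases
              case 1
              then show ?thesis using Le[OF R.y_in agree_refl near[OF t]] k
                by (simp add: L.cls_shift_y hy)
            next
              case (2 m)
              then obtain j where j: "m = k + p * j" by (metis dvdE add.commute diff_add_cancel)
              have "t + of_int m \<le> A" using 2(1) M_real t1 by linarith
              then have "\<tau> (t + of_int m) = (t + of_int k) * slope + of_int (p' * j)"
                by (simp only: \<tau>_left j of_int_add slope_mult_period distrib_right add.assoc)
              \<comment> \<open>The integer \<open>p' * j\<close> moves into the sequence. The
                remaining real coordinate is the one for the nearby circle point, so only windows of
                \<open>x'\<close> and \<open>y'\<close> are left to compare.\<close>
              then have eq: "h (L.cls (w, t)) = R.cls (shift_pow (p' * j) x', (t + of_int k) * slope)"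
                by (simp add: 2(2) L.cls_shift_x hx R.cls_shift_x)
              have "p * K \<le> p * (- j)" using 2(1) j M by simp
              then have "p' * j \<le> - M'" using K[of "- j"] by (simp add: K_def)
              then have "agree L (shift_pow (p' * j) x') y'"
                using M'_left R.period[of "p' * j"] by (metis dvd_triv_left)
              then show ?thesis unfolding eq
                by (rule Le[OF shift_pow_generated_subshift[OF R.x_in] agree_sym near[OF t]])
            next
              case (3 m)
              then obtain j where "m - c - k = p * j" by (metis dvdE)
              then have j: "m = c + k + p * j" by simp
              have "B \<le> t + of_int m" using 3(1) M_real t1 by linarith
              \<comment> \<open>The \<open>c\<close> contained in \<open>m\<close> cancels the one
                in \<open>\<tau>\<close>, and \<open>c'\<close> takes its place, which is exactly
                the lag of \<open>x'\<close> behind \<open>y'\<close>.\<close>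
              then have "\<tau> (t + of_int m) = ((t + of_int k) + of_int (p * j)) * slope + of_int c'"
                by (subst \<tau>_right) (simp_all add: j algebra_simps)
              then have "\<tau> (t + of_int m) = (t + of_int k) * slope + of_int (p' * j + c')"
                by (simp only: of_int_add slope_mult_period distrib_right add.assoc)
              then have eq: "h (L.cls (w, t)) = R.cls (shift_pow (p' * j + c') x', (t + of_int k) * slope)"
                by (simp add: 3(2) L.cls_shift_x hx R.cls_shift_x)
              have "p * K \<le> p * j" using 3(1) j M by simp
              then have "M' \<le> p' * j + c'" using K[of j] by (simp add: K_def)
              then have "agree L (shift_pow (p' * j + c') x') y'"
                using M'_right[of "p' * j + c'"] R.period[of "p' * j"] by simp
              then show ?thesis unfolding eq
                by (rule Le[OF shift_pow_generated_subshift[OF R.x_in] agree_sym near[OF t]])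
            qed
          qed
          then show ?thesis using d(1) by blast
        qed
      qed
      then show "\<exists>L e. e > 0 \<and> (\<forall>w\<in>?X. \<forall>t. agree L z w \<longrightarrow> \<bar>t - s\<bar> < e \<longrightarrow>
          (w, t) \<in> {p \<in> ?X \<times> UNIV. h (L.cls p) \<in> U})"
        by simp
    qed
  qed auto
  ultimately show "continuous_map (shift_cylinder ?X) (suspension ?X') (h \<circ> L.cls)"
    unfolding continuous_map_def by (auto simp: L.cls_in_topspace)
qed

text \<open>The assumption says that \<open>\<tau>\<close> has to gain a nonnegative amount between
  its two affine pieces, so it can be chosen increasing.\<close>

lemma flow_equivalent:
  assumes delay: "of_int c * slope \<le> of_int c'"
  shows "flow_equivalent (generated_subshift x) (generated_subshift x')"
proof -
  let ?X = "generated_subshift x" and ?X' = "generated_subshift x'"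
  \<comment> \<open>The pair with its roles exchanged supplies the inverse map and its
    continuity.\<close>
  interpret inv_pair: homoclinic_pair x' y' p' c' x y p c ..
  have inv_slope: "inv_pair.slope = 1 / slope" by (simp add: slope_def inv_pair.slope_def)
  define d where "d = of_int c' - of_int c * slope"
  \<comment> \<open>A line of slope \<open>slope\<close> plus a ramp of height \<open>d\<close> on
    the unit interval; it is affine below 0 and above 1.\<close>
  define \<tau> where "\<tau> s = s * slope + d * max 0 (min 1 s)" for s
  define \<rho> where "\<rho> = inv \<tau>"
  have d: "0 \<le> d" using delay by (simp add: d_def)
  have mono: "strict_mono \<tau>"
  proof
    fix s t :: real assume "s < t"
    moreover from this have "max 0 (min 1 s) \<le> max 0 (min 1 t)" by linarith
    ultimately show "\<tau> s < \<tau> t"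
      unfolding \<tau>_def using slope_pos d by (intro add_less_le_mono mult_left_mono mult_strict_right_mono) auto
  qed
  have cont: "continuous_on UNIV \<tau>" unfolding \<tau>_def by (intro continuous_intros)
  have left: "\<tau> s = s * slope" if "s \<le> 0" for s using that by (simp add: \<tau>_def)
  have right: "\<tau> s = (s - of_int c) * slope + of_int c'" if "1 \<le> s" for s
    using that by (simp add: \<tau>_def d_def left_diff_distrib)
  have surj: "surj \<tau>"
  proof (rule surjI)
    show "\<tau> (SOME s. \<tau> s = t) = t" for t
    proof (rule someI_ex)
      \<comment> \<open>The bounds 0 and 1 keep \<open>a\<close> and \<open>b\<close> on the affine
        pieces, where the inequalities \<open>\<tau> a \<le> t\<close> and
        \<open>t \<le> \<tau> b\<close> can be solved explicitly.\<close>
      define a where "a = min 0 (t / slope)"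
      define b where "b = max 1 ((t - of_int c') / slope + of_int c)"
      have "a \<le> 0" "a \<le> t / slope" by (auto simp: a_def)
      then have "\<tau> a \<le> t" using left[of a] slope_pos by (simp only: pos_le_divide_eq)
      moreover have "1 \<le> b" "(t - of_int c') / slope \<le> b - of_int c" by (auto simp: b_def)
      then have "t \<le> \<tau> b" using right[of b] slope_pos by (simp only: pos_divide_le_eq)
      moreover have "a \<le> b" using \<open>a \<le> 0\<close> \<open>1 \<le> b\<close> by simp
      ultimately show "\<exists>s. \<tau> s = t"
        using IVT'[of \<tau> a t b] cont continuous_on_subset by blast
    qed
  qed
  have inj: "inj \<tau>" using mono by (rule strict_mono_imp_inj_on)
  have \<rho>\<tau>: "\<rho> (\<tau> s) = s" and \<tau>\<rho>: "\<tau> (\<rho> s) = s" for s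
    using inj surj by (simp_all add: \<rho>_def surj_f_inv_f)
  have mono_\<rho>: "\<rho> s \<le> \<rho> t" if "s \<le> t" for s t
    using that strict_mono_less_eq[OF mono, of "\<rho> s" "\<rho> t"] by (simp add: \<tau>\<rho>)
  have "range \<rho> = UNIV" using \<rho>\<tau> by (metis surjI)
  \<comment> \<open>A monotone function whose range is the whole line has no jumps.\<close>
  then have cont_\<rho>: "continuous_on UNIV \<rho>"
    by (intro continuous_onI_mono mono_\<rho>) auto
  have left_\<rho>: "\<rho> t = t * inv_pair.slope" if "t \<le> 0" for t
  proof -
    have "t / slope \<le> 0" using that slope_pos by (simp only: divide_nonpos_pos)
    then have "\<tau> (t / slope) = t" using left slope_pos by simp
    then have "\<rho> t = t / slope" using \<rho>\<tau> by metis
    then show ?thesis by (simp add: inv_slope)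
  qed
  have right_\<rho>: "\<rho> t = (t - of_int c') * inv_pair.slope + of_int c" if "\<tau> 1 \<le> t" for t
  proof -
    have "1 \<le> \<rho> t" using mono_\<rho>[OF that] \<rho>\<tau> by simp
    then have "t = (\<rho> t - of_int c) * slope + of_int c'" using right[of "\<rho> t"] \<tau>\<rho> by simp
    then have "\<rho> t - of_int c = (t - of_int c') / slope"
      using slope_pos by (metis add_diff_cancel_right' less_irrefl nonzero_mult_div_cancel_right)
    then show ?thesis by (simp add: inv_slope)
  qed
  obtain h where hx: "\<And>s. h (L.cls (x, s)) = R.cls (x', \<tau> s)"
    and hy: "\<And>s. h (L.cls (y, s)) = R.cls (y', s * slope)"
    using exists_map[of \<tau>] by blast
  obtain g where gx: "\<And>s. g (R.cls (x', s)) = L.cls (x, \<rho> s)"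
    and gy: "\<And>s. g (R.cls (y', s)) = L.cls (y, s * inv_pair.slope)"
    using inv_pair.exists_map[of \<rho>] by blast
  have "continuous_map (suspension ?X) (suspension ?X') h"
    using cont left right hx hy by (rule continuous_map_suspension)
  moreover have "continuous_map (suspension ?X') (suspension ?X) g"
    using cont_\<rho> left_\<rho> right_\<rho> gx gy by (rule inv_pair.continuous_map_suspension)
  moreover have "g (h P) = P" if "P \<in> topspace (suspension ?X)" for P
    using that by (rule L.topspace_cases) (use slope_pos in \<open>simp_all add: inv_slope hx hy gx gy \<rho>\<tau>\<close>)
  moreover have "h (g P) = P" if "P \<in> topspace (suspension ?X')" for P
    using that by (rule R.topspace_cases) (use slope_pos in \<open>simp_all add: inv_slope hx hy gx gy \<tau>\<rho>\<close>)
  ultimately have homeo: "homeomorphic_map (suspension ?X) (suspension ?X') h"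
    unfolding homeomorphic_map_maps homeomorphic_maps_def by blast
  have orient: "orientation_preserving ?X h"
    unfolding orientation_preserving_def
  proof
    fix P assume "P \<in> topspace (suspension ?X)"
    then show "\<exists>\<tau>. strict_mono \<tau> \<and> continuous_on UNIV \<tau> \<and> surj \<tau> \<and>
        (\<forall>t. h (suspension_flow t P) = suspension_flow (\<tau> t) (h P))"
    proof (rule L.topspace_cases)
      fix s assume P: "P = L.cls (x, s)"
      \<comment> \<open>Flow time is measured from the starting point, hence the subtraction of
        \<open>\<tau> s\<close>.\<close>
      let ?\<tau> = "\<lambda>t. \<tau> (s + t) - \<tau> s"
      have "strict_mono ?\<tau>" using mono by (simp add: strict_mono_def)
      moreover have "continuous_on UNIV ?\<tau>"
        by (intro continuous_intros continuous_on_compose2[OF cont]) auto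
      moreover have "?\<tau> (\<rho> (t + \<tau> s) - s) = t" for t by (simp add: \<tau>\<rho>)
      then have "surj ?\<tau>" by (rule surjI)
      ultimately show ?thesis
        by (intro exI[of _ ?\<tau>]) (simp add: P suspension_flow_class hx)
    next
      fix s assume P: "P = L.cls (y, s)"
      let ?\<tau> = "\<lambda>t. t * slope"
      have "strict_mono ?\<tau>"
        using slope_pos by (intro strict_monoI mult_strict_right_mono)
      moreover have "continuous_on UNIV ?\<tau>" by (intro continuous_intros)
      moreover have "?\<tau> (t / slope) = t" for t using slope_pos by simp
      then have "surj ?\<tau>" by (rule surjI)
      ultimately show ?thesis
        by (intro exI[of _ ?\<tau>]) (simp add: P suspension_flow_class hy distrib_right)
    qed
  qed
  have "h ` M \<in> flow_lines ?X'" if line: "M \<in> flow_lines ?X" for M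
  proof -
    obtain P where P: "P \<in> topspace (suspension ?X)" and M: "M = range (\<lambda>t. suspension_flow t P)"
      using line unfolding flow_lines_def by blast
    obtain \<theta> :: "real \<Rightarrow> real" where \<theta>: "surj \<theta>"
      "\<And>t. h (suspension_flow t P) = suspension_flow (\<theta> t) (h P)"
      using orient P unfolding orientation_preserving_def by blast
    \<comment> \<open>Surjectivity of \<open>\<theta>\<close> ensures that the image is a whole flow
      line and not just a piece of one.\<close>
    have "h ` M = (\<lambda>t. suspension_flow t (h P)) ` range \<theta>"
      unfolding M image_image \<theta>(2) by (rule refl)
    then have "h ` M = range (\<lambda>t. suspension_flow t (h P))" using \<theta>(1) by simp
    moreover have "h P \<in> topspace (suspension ?X')"
      using homeo P homeomorphic_imp_surjective_map by blast
    ultimately show ?thesis unfolding flow_lines_def by blast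
  qed
  then show ?thesis using homeo orient unfolding flow_equivalent_def by blast
qed

end

theorem theorem2p4:
  fixes x :: "int \<Rightarrow> 'a::finite" and x' :: "int \<Rightarrow> 'b::finite"
  assumes "eventually_periodic x" and "eventually_periodic x'"
  shows "flow_equivalent (generated_subshift x) (generated_subshift x')"
proof -
  obtain y p c where "homoclinic x y p c"
    using assms(1) by (rule eventually_periodic_homoclinic)
  moreover obtain y' p' c' where "homoclinic x' y' p' c'"
    using assms(2) by (rule eventually_periodic_homoclinic)
  ultimately interpret homoclinic_pair x y p c x' y' p' c'
    by (rule homoclinic_pair.intro)
  \<comment> \<open>With \<open>j\<close> nonnegative, multiplying by \<open>p'\<close>, which is at
    least 1, can only increase it, so adding \<open>p' * j\<close> to the lag covers the
    deficit.\<close>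
  define j where "j = \<lceil>max 0 (of_int c * slope - of_int c')\<rceil>"
  have j: "0 \<le> j" "of_int c * slope - of_int c' \<le> of_int j"
    unfolding j_def by (simp, rule order_trans[OF max.cobounded2 le_of_int_ceiling])
  have "j \<le> p' * j" using j(1) R.p_pos mult_right_mono[of 1 p' j] by simp
  then have "of_int j \<le> (of_int (p' * j) :: real)" by (simp only: of_int_le_iff)
  then have delay: "of_int c * slope \<le> of_int (c' + p' * j)" using j(2) by simp
  \<comment> \<open>\<open>slope\<close> depends on \<open>p\<close> and \<open>p'\<close> alone, so
    \<open>delay\<close> is also the inequality for the new lag.\<close>
  interpret delayed: homoclinic_pair x y p c x' y' p' "c' + p' * j"
    by (rule homoclinic_pair.intro[OF L.homoclinic_axioms R.homoclinic_add_period])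
  show ?thesis using delay by (rule delayed.flow_equivalent)
qed

end
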